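(* Let $X=(X_1,\ldots,X_n)$ be a vector of independent standard normal random variables. Let $h:\mathbb{R}^n\to\mathbb{R}$ be measurable with $\mathbb{E}(h(X)^2)<\infty$, let $g:\mathbb{R}\to\mathbb{R}$ be Lipschitz continuous with constant $L$, and let $f=g\circ h$. Let $a=(a_1,\ldots,a_n)^\top\in\mathbb{R}^n$ with $a_j=\mathbb{E}(X_j h(X))$. If $\|a\|=0$ let $U=I$ be the identity matrix; otherwise let $U$ be a Householder reflection of $\mathbb{R}^n$ with $Ue_1=a/\|a\|$. Put $$Y:=\|a\|X_1,\qquad Z:=h(UX)-\|a\|X_1,$$ and suppose that $Y$ and $Z$ are independent. Then $$\mathbb{V}(f(UX))-\mathbb{V}\bigl(\mathbb{E}(f(UX)\mid X_1)\bigr)\le 2L^2\bigl(\mathbb{V}(h(UX))-\|a\|^2\bigr).$$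
   Context: $\mathbb{E}$ denotes expectation, $\mathbb{V}$ denotes variance, $\|\cdot\|$ is the Euclidean norm, and $e_1=(1,0,\ldots,0)^\top$. A Householder reflection is a matrix of the form $U=I-2\,\frac{vv^\top}{v^\top v}$ with $0\neq v\in\mathbb{R}^n$; it is orthogonal and symmetric. $\mathbb{E}(\cdot\mid X_1)$ is conditional expectation given the $\sigma$-algebra generated by $X_1$. *)

theory Defs
  imports "HOL-Probability.Probability"
begin

definition householder :: "real ^ 'n ^ 'n \<Rightarrow> bool" where
  "householder U \<longleftrightarrow>
     (\<exists>v :: real ^ 'n. v \<noteq> 0 \<and>
        U = mat 1 - (2 / (v \<bullet> v)) *\<^sub>R ((columnvector v :: real ^ 1 ^ 'n) ** rowvector v))"

definition cond_exp_given :: "'a measure \<Rightarrow> ('a \<Rightarrow> real) \<Rightarrow> ('a \<Rightarrow> real) \<Rightarrow> 'a \<Rightarrow> real" where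
  "cond_exp_given M W V = real_cond_exp M (vimage_algebra (space M) W borel) V"

end

theory Submission
  imports Defs
begin

text \<open>
  The idea is to compare the conditional expectation of \<open>V = f (U X)\<close> with one cleverly chosen
  function of \<open>X\<^sub>1\<close>.  Since \<open>\<bbbE>(V | X\<^sub>1)\<close> is the orthogonal projection of \<open>V\<close> onto the
  square-integrable functions of \<open>X\<^sub>1\<close>, Pythagoras shows that
  \<open>\<bbbV>(V) - \<bbbV>(\<bbbE>(V | X\<^sub>1)) \<le> \<bbbE>((V - \<phi>)\<^sup>2)\<close> for every such function \<open>\<phi>\<close>
  (\<open>variance_cond_exp_gap_le\<close>).

  Here \<open>V = g (Y + Z)\<close> and \<open>Y\<close> depends on \<open>X\<^sub>1\<close> alone, so the natural competitor replaces \<open>Z\<close>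
  by its mean: \<open>\<phi> = g (Y + \<bbbE>(Z))\<close>.  The Lipschitz condition bounds \<open>\<bar>V - \<phi>\<bar>\<close> by
  \<open>L \<bar>Z - \<bbbE>(Z)\<bar>\<close>, hence the gap by \<open>L\<^sup>2 \<bbbV>(Z)\<close>.  As \<open>Y\<close> and \<open>Z\<close> are independent and
  \<open>\<bbbV>(Y) = \<parallel>a\<parallel>\<^sup>2\<close>, variances add up to \<open>\<bbbV>(h (U X)) = \<parallel>a\<parallel>\<^sup>2 + \<bbbV>(Z)\<close>.  This gives the
  inequality even with \<open>L\<^sup>2\<close> in place of \<open>2 L\<^sup>2\<close>.

  All of this takes place among square-integrable variables, whereas the hypothesis speaks of
  \<open>h (X)\<close> and not of \<open>h (U X)\<close>.  The bridge is the rotation invariance of the standard Gaussian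
  law (\<open>std_normal_vector_orthogonal_distr\<close>): its density depends on the norm alone, and Lebesgue
  measure is invariant under orthogonal maps (\<open>orthogonal_transformation_lborel\<close>).
\<close>

section \<open>Orthogonal transformations and Lebesgue measure\<close>

lemma orthogonal_transformation_borel_measurable:
  fixes T :: "'a::euclidean_space \<Rightarrow> 'a"
  assumes "orthogonal_transformation T"
  shows "T \<in> borel_measurable borel"
  using orthogonal_transformation_linear[OF assms]
  by (intro borel_measurable_continuous_onI linear_continuous_on)
    (simp add: linear_conv_bounded_linear)

text \<open>
  Push-forward along \<open>T\<close> yields another translation-invariant measure, so it is a multiple of
  Lebesgue measure, and the factor is 1 because \<open>T\<close> preserves the unit ball.  Both steps are done
  at once by evaluating
  \<open>\<integral>\<integral> 1\<^sub>A (T x) 1\<^sub>B (y + T x)\<close> in the two orders of integration, which shows that the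
  two measures of \<open>A\<close> and \<open>B\<close> are proportional; \<open>B\<close> is then taken to be the unit ball.
\<close>

lemma orthogonal_transformation_lborel:
  fixes T :: "'a::euclidean_space \<Rightarrow> 'a"
  assumes T: "orthogonal_transformation T"
  shows "distr lborel borel T = lborel"
proof (rule measure_eqI)
  have lin: "linear T" using T by (rule orthogonal_transformation_linear)
  note [measurable] = orthogonal_transformation_borel_measurable[OF T]
  show "sets (distr lborel borel T) = sets lborel" by simp
  fix A assume "A \<in> sets (distr lborel borel T)"
  then have A[measurable]: "A \<in> sets borel" by simp
  define B :: "'a set" where "B = ball 0 1"
  have B[measurable]: "B \<in> sets borel" by (simp add: B_def)
  have swap: "emeasure lborel (T -` A) * emeasure lborel B
      = emeasure lborel (T -` B) * emeasure lborel A"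
  proof -
    have [measurable]: "T -` A \<in> sets borel" "T -` B \<in> sets borel"
      using measurable_sets[of T borel borel A] measurable_sets[of T borel borel B] by auto
    have shift: "(\<integral>\<^sup>+y. f (y + c) \<partial>lborel) = (\<integral>\<^sup>+y. f y \<partial>lborel)"
      if [measurable]: "f \<in> borel_measurable borel" for f :: "'a \<Rightarrow> ennreal" and c
    proof -
      have "(\<integral>\<^sup>+y. f y \<partial>lborel) = (\<integral>\<^sup>+y. f y \<partial>distr lborel borel ((+) c))"
        by (simp add: lborel_distr_plus)
      also have "\<dots> = (\<integral>\<^sup>+y. f (c + y) \<partial>lborel)" by (subst nn_integral_distr) auto
      finally show ?thesis by (simp add: add.commute)
    qed
    have reflect: "(\<integral>\<^sup>+y. f (c - y) \<partial>lborel) = (\<integral>\<^sup>+y. f y \<partial>lborel)"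
      if [measurable]: "f \<in> borel_measurable borel" for f :: "'a \<Rightarrow> ennreal" and c
    proof -
      have "(lborel :: 'a measure) = distr lborel borel (\<lambda>y. c - y)"
        using lborel_affine[of "-1" c] by (simp add: density_1)
      then have "(\<integral>\<^sup>+y. f y \<partial>lborel) = (\<integral>\<^sup>+y. f y \<partial>distr lborel borel (\<lambda>y. c - y))"
        by simp
      also have "\<dots> = (\<integral>\<^sup>+y. f (c - y) \<partial>lborel)" by (subst nn_integral_distr) auto
      finally show ?thesis by simp
    qed
    have "emeasure lborel (T -` A) * emeasure lborel B
        = (\<integral>\<^sup>+x. indicator A (T x) * (\<integral>\<^sup>+y. indicator B y \<partial>lborel) \<partial>lborel)"
      by (subst nn_integral_multc) (auto simp flip: indicator_vimage)
    also have "\<dots> = (\<integral>\<^sup>+x. indicator A (T x) * (\<integral>\<^sup>+y. indicator B (y + T x) \<partial>lborel) \<partial>lborel)"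
      by (intro nn_integral_cong arg_cong2[where f="(*)"] shift[symmetric] refl) auto
    also have "\<dots> = (\<integral>\<^sup>+x. (\<integral>\<^sup>+y. indicator A (T x) * indicator B (y + T x) \<partial>lborel) \<partial>lborel)"
      by (intro nn_integral_cong nn_integral_cmult[symmetric]) auto
    also have "\<dots> = (\<integral>\<^sup>+y. (\<integral>\<^sup>+x. indicator A (T x) * indicator B (y + T x) \<partial>lborel) \<partial>lborel)"
      by (intro lborel_pair.Fubini') auto
    \<comment> \<open>Replace \<open>T x\<close> by \<open>T x - y\<close>: a translation of \<open>x\<close>, because \<open>T\<close> is linear and onto.\<close>
    also have "\<dots> = (\<integral>\<^sup>+y. (\<integral>\<^sup>+x. indicator A (T x - y) * indicator B (T x) \<partial>lborel) \<partial>lborel)"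
    proof (rule nn_integral_cong)
      fix y
      obtain z where z: "T z = - y"
        using orthogonal_transformation_surj[OF T] by (metis surjD)
      have "(\<integral>\<^sup>+x. indicator A (T x) * indicator B (y + T x) \<partial>lborel)
          = (\<integral>\<^sup>+x. indicator A (T (x + z)) * indicator B (y + T (x + z)) \<partial>lborel)"
        by (rule shift[symmetric]) auto
      then show "(\<integral>\<^sup>+x. indicator A (T x) * indicator B (y + T x) \<partial>lborel)
          = (\<integral>\<^sup>+x. indicator A (T x - y) * indicator B (T x) \<partial>lborel)"
        by (simp add: linear_add[OF lin] z)
    qed
    also have "\<dots> = (\<integral>\<^sup>+x. (\<integral>\<^sup>+y. indicator A (T x - y) * indicator B (T x) \<partial>lborel) \<partial>lborel)"
      by (intro lborel_pair.Fubini') auto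
    also have "\<dots> = (\<integral>\<^sup>+x. (\<integral>\<^sup>+y. indicator A (T x - y) \<partial>lborel) * indicator B (T x) \<partial>lborel)"
      by (intro nn_integral_cong nn_integral_multc) auto
    also have "\<dots> = (\<integral>\<^sup>+x. (\<integral>\<^sup>+y. indicator A y \<partial>lborel) * indicator B (T x) \<partial>lborel)"
      by (intro nn_integral_cong arg_cong2[where f="(*)"] reflect refl) auto
    also have "\<dots> = emeasure lborel A * emeasure lborel (T -` B)"
      by (subst nn_integral_cmult) (auto simp flip: indicator_vimage)
    finally show ?thesis by (simp add: mult.commute)
  qed
  have "T -` B = B"
    using orthogonal_transformation_norm[OF T] by (auto simp: B_def)
  moreover have "emeasure lborel B \<noteq> 0"
    using content_ball_pos[of 1 "0 :: 'a"] by (auto simp: B_def measure_def)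
  moreover have "emeasure lborel B \<noteq> \<infinity>"
    using emeasure_lborel_ball_finite[of 0 1] by (auto simp: B_def less_top)
  ultimately have "emeasure lborel (T -` A) = emeasure lborel A"
    using swap by (metis infinity_ennreal_def mult.commute mult_divide_eq_ennreal)
  then show "emeasure (distr lborel borel T) A = emeasure lborel A"
    by (simp add: emeasure_distr)
qed

lemma householder_orthogonal:
  fixes U :: "real ^ 'n ^ 'n"
  assumes "householder U"
  shows "orthogonal_transformation ((*v) U)"
proof -
  obtain v where v: "v \<noteq> 0"
    and U: "U = mat 1 - (2 / (v \<bullet> v)) *\<^sub>R ((columnvector v :: real ^ 1 ^ 'n) ** rowvector v)"
    using assms unfolding householder_def by blast
  have rank1: "((columnvector v :: real ^ 1 ^ 'n) ** rowvector v) *v x = (v \<bullet> x) *\<^sub>R v" for x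
    by (simp add: vec_eq_iff matrix_matrix_mult_def matrix_vector_mult_def columnvector_def
        rowvector_def inner_vec_def sum_distrib_left sum_distrib_right mult_ac)
  have Ux: "U *v x = x - (2 * (v \<bullet> x) / (v \<bullet> v)) *\<^sub>R v" for x
    unfolding U by (simp add: matrix_vector_mult_diff_rdistrib scaleR_matrix_vector_assoc[symmetric] rank1)
  have "(U *v x) \<bullet> (U *v y) = x \<bullet> y" for x y
    using v unfolding Ux
    by (simp add: inner_diff_left inner_diff_right inner_commute field_simps)
  then show ?thesis
    by (simp add: orthogonal_transformation_def)
qed

section \<open>Rotation invariance of the standard Gaussian vector\<close>

lemma borel_measurable_vec:
  fixes X :: "'a \<Rightarrow> real ^ 'n"
  assumes "\<And>j. (\<lambda>\<omega>. X \<omega> $ j) \<in> borel_measurable M"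
  shows "X \<in> borel_measurable M"
  using assms by (subst borel_measurable_euclidean_space) (auto simp: Basis_vec_def inner_axis)

text \<open>
  Boxes generate the Borel sets, and on a box both sides factor over the coordinates: the left one
  by independence, the right one by Fubini.
\<close>
lemma (in prob_space) std_normal_vector_distr:
  fixes X :: "'a \<Rightarrow> real ^ 'n"
  assumes indep: "indep_vars (\<lambda>_. borel) (\<lambda>j \<omega>. X \<omega> $ j) UNIV"
    and dist: "\<And>j. distributed M lborel (\<lambda>\<omega>. X \<omega> $ j) std_normal_density"
  shows "distr M borel X = density lborel (\<lambda>x. \<Prod>j\<in>UNIV. ennreal (std_normal_density (x $ j)))"
    (is "?P = ?Q")
proof -
  have Xj[measurable]: "(\<lambda>\<omega>. X \<omega> $ j) \<in> borel_measurable M" for j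
    using distributed_measurable[OF dist[of j]] by simp
  have X[measurable]: "X \<in> borel_measurable M"
    by (rule borel_measurable_vec) simp
  have Basis: "(\<Prod>b\<in>Basis. F b) = (\<Prod>j\<in>UNIV. F (axis j 1))" for F :: "real ^ 'n \<Rightarrow> ennreal"
    by (subst prod.reindex[of "\<lambda>j. axis j (1::real)", symmetric, unfolded comp_def])
       (auto simp: inj_on_def axis_eq_axis Basis_vec_def intro!: prod.cong)
  let ?E = "range (\<lambda>(a, b). box a b :: (real ^ 'n) set)"
  let ?A = "\<lambda>n::nat. box (- (real n *\<^sub>R One)) (real n *\<^sub>R One) :: (real ^ 'n) set"
  show ?thesis
  proof (rule measure_eqI_generator_eq[of ?E UNIV _ _ ?A])
    show "Int_stable ?E" by (auto simp: Int_stable_def box_Int_box)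
    show "?E \<subseteq> Pow UNIV" "sets ?P = sigma_sets UNIV ?E" "sets ?Q = sigma_sets UNIV ?E"
      by (simp_all add: borel_eq_box)
    show "range ?A \<subseteq> ?E" "(\<Union>i. ?A i) = UNIV"
      unfolding UN_box_eq_UNIV by auto
    show "emeasure ?P (?A i) \<noteq> \<infinity>" for i
      by (simp add: emeasure_distr)
    fix S assume "S \<in> ?E"
    then obtain l u where S: "S = box l u" by auto
    define I where "I j = {l $ j <..< u $ j}" for j
    have mem: "x \<in> S \<longleftrightarrow> (\<forall>j. x $ j \<in> I j)" for x
      by (simp add: S I_def mem_box_cart)
    have "emeasure ?P S = emeasure M (\<Inter>j\<in>UNIV. (\<lambda>\<omega>. X \<omega> $ j) -` I j \<inter> space M)"
      by (auto simp: emeasure_distr S mem[unfolded S] intro!: arg_cong[where f="emeasure M"])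
    also have "\<dots> = (\<Prod>j\<in>UNIV. emeasure M ((\<lambda>\<omega>. X \<omega> $ j) -` I j \<inter> space M))"
      using indep_varsD_finite[OF indep, of I]
      by (simp add: emeasure_eq_measure prod_ennreal I_def)
    also have "\<dots> = (\<Prod>j\<in>UNIV. \<integral>\<^sup>+t. ennreal (std_normal_density t) * indicator (I j) t \<partial>lborel)"
      by (intro prod.cong refl distributed_emeasure[OF dist]) (simp add: I_def)
    also have "\<dots> = (\<Prod>b\<in>Basis. \<integral>\<^sup>+t. ennreal (std_normal_density t)
                        * indicator {l \<bullet> b <..< u \<bullet> b} t \<partial>lborel)"
      by (simp add: Basis I_def inner_axis)
    also have "\<dots> = (\<integral>\<^sup>+x. (\<Prod>b\<in>Basis. ennreal (std_normal_density (x \<bullet> b))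
                        * indicator {l \<bullet> b <..< u \<bullet> b} (x \<bullet> b)) \<partial>lborel)"
      by (rule nn_integral_lborel_prod[symmetric]) auto
    also have "\<dots> = (\<integral>\<^sup>+x. (\<Prod>j\<in>UNIV. ennreal (std_normal_density (x $ j))) * indicator S x \<partial>lborel)"
    proof (rule nn_integral_cong)
      fix x :: "real ^ 'n"
      have "(\<Prod>j\<in>UNIV. indicator (I j) (x $ j)) = (indicator S x :: ennreal)"
        by (auto simp: mem indicator_def)
      then show "(\<Prod>b\<in>Basis. ennreal (std_normal_density (x \<bullet> b))
                  * indicator {l \<bullet> b <..< u \<bullet> b} (x \<bullet> b))
          = (\<Prod>j\<in>UNIV. ennreal (std_normal_density (x $ j))) * indicator S x"
        by (simp add: Basis I_def inner_axis prod.distrib)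
    qed
    also have "\<dots> = emeasure ?Q S"
      by (simp add: emeasure_density S)
    finally show "emeasure ?P S = emeasure ?Q S" .
  qed
qed

lemma prod_std_normal_density_eq_norm:
  fixes x :: "real ^ 'n"
  shows "(\<Prod>j\<in>UNIV. ennreal (std_normal_density (x $ j)))
    = ennreal ((1 / sqrt (2 * pi)) ^ CARD('n) * exp (- (norm x)\<^sup>2 / 2))"
proof -
  have "(\<Prod>j\<in>UNIV. std_normal_density (x $ j))
      = (1 / sqrt (2 * pi)) ^ CARD('n) * exp (\<Sum>j\<in>UNIV. - (x $ j)\<^sup>2 / 2)"
    by (simp add: std_normal_density_def prod.distrib exp_sum power_divide prod_dividef)
  also have "(\<Sum>j\<in>UNIV. - (x $ j)\<^sup>2 / 2) = - (norm x)\<^sup>2 / 2"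
    by (simp add: norm_vec_def L2_set_def sum_nonneg sum_negf sum_divide_distrib)
  finally show ?thesis by (simp add: prod_ennreal)
qed

lemma (in prob_space) std_normal_vector_orthogonal_distr:
  fixes X :: "'a \<Rightarrow> real ^ 'n"
  assumes indep: "indep_vars (\<lambda>_. borel) (\<lambda>j \<omega>. X \<omega> $ j) UNIV"
    and dist: "\<And>j. distributed M lborel (\<lambda>\<omega>. X \<omega> $ j) std_normal_density"
    and T: "orthogonal_transformation T"
  shows "distr M borel (\<lambda>\<omega>. T (X \<omega>)) = distr M borel X"
proof -
  note [measurable] = orthogonal_transformation_borel_measurable[OF T]
  have X[measurable]: "X \<in> borel_measurable M"
    using distributed_measurable[OF dist] by (intro borel_measurable_vec) simp
  define p where "p x = (\<Prod>j\<in>UNIV. ennreal (std_normal_density (x $ j)))" for x :: "real ^ 'n"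
  have [measurable]: "p \<in> borel_measurable borel"
    unfolding p_def by measurable
  have pT: "p (T x) = p x" for x
    by (simp add: p_def prod_std_normal_density_eq_norm orthogonal_transformation_norm[OF T])
  have "distr M borel (\<lambda>\<omega>. T (X \<omega>)) = distr (distr M borel X) borel T"
    by (subst distr_distr) (auto simp: comp_def)
  also have "distr M borel X = density lborel p"
    unfolding p_def using indep dist by (rule std_normal_vector_distr)
  also have "distr (density lborel p) borel T = distr (density lborel (\<lambda>x. p (T x))) borel T"
    by (simp add: pT)
  also have "\<dots> = density (distr lborel borel T) p"
    by (rule density_distr[symmetric]) auto
  also have "\<dots> = distr M borel X"
    using std_normal_vector_distr[OF indep dist]
    by (simp add: orthogonal_transformation_lborel[OF T] p_def[abs_def])
  finally show ?thesis .
qed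

section \<open>Conditional expectation as a least-squares projection\<close>

lemma integrable_mult_of_square:
  fixes f g :: "'a \<Rightarrow> real"
  assumes [measurable]: "f \<in> borel_measurable M" "g \<in> borel_measurable M"
    and f: "integrable M (\<lambda>x. (f x)\<^sup>2)" and g: "integrable M (\<lambda>x. (g x)\<^sup>2)"
  shows "integrable M (\<lambda>x. f x * g x)"
proof (rule Bochner_Integration.integrable_bound)
  show "integrable M (\<lambda>x. (f x)\<^sup>2 + (g x)\<^sup>2)" using f g by simp
  have "\<bar>s * t\<bar> \<le> s\<^sup>2 + t\<^sup>2" for s t :: real
    using sum_squares_bound[of s t] sum_squares_bound[of s "- t"] sum_power2_ge_zero[of s t]
    unfolding abs_le_iff mult.assoc power2_minus mult_minus_right by linarith
  then show "AE x in M. norm (f x * g x) \<le> norm ((f x)\<^sup>2 + (g x)\<^sup>2)"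
    by simp
qed measurable

text \<open>
  Tower property: \<open>V\<close> and its conditional expectation \<open>C\<close> have the same mean and the same inner
  product with \<open>\<phi>\<close>.  So the right side exceeds the left by exactly \<open>\<bbbE>((C - \<phi>)\<^sup>2)\<close>, and the
  proof starts from the nonnegativity of this number.
\<close>
lemma (in prob_space) variance_cond_exp_gap_le:
  fixes V \<phi> :: "'a \<Rightarrow> real"
  assumes sub: "subalgebra M F"
    and V[measurable]: "V \<in> borel_measurable M" and V2: "integrable M (\<lambda>x. (V x)\<^sup>2)"
    and \<phi>[measurable]: "\<phi> \<in> borel_measurable F" and \<phi>2: "integrable M (\<lambda>x. (\<phi> x)\<^sup>2)"
  shows "variance V - variance (real_cond_exp M F V) \<le> expectation (\<lambda>x. (V x - \<phi> x)\<^sup>2)"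
proof -
  interpret finite_measure_subalgebra M F
    by unfold_locales (rule sub)
  define C where "C = real_cond_exp M F V"
  have [measurable]: "C \<in> borel_measurable M" by (simp add: C_def)
  have \<phi>M[measurable]: "\<phi> \<in> borel_measurable M"
    by (rule measurable_from_subalg[OF sub \<phi>])
  have V1: "integrable M V" using square_integrable_imp_integrable[OF V V2] .
  have C1: "integrable M C" unfolding C_def by (rule real_cond_exp_int(1)[OF V1])
  have EC: "expectation C = expectation V"
    unfolding C_def by (rule real_cond_exp_int(2)[OF V1])
  \<comment> \<open>Conditional Jensen inequality for the square function.\<close>
  have C2: "integrable M (\<lambda>x. (C x)\<^sup>2)"
    unfolding C_def
    by (rule integrable_convex_cond_exp[OF V1, of UNIV])
       (auto simp: V2 convex_power2)
  have V\<phi>: "integrable M (\<lambda>x. \<phi> x * V x)"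
    by (rule integrable_mult_of_square[OF \<phi>M V \<phi>2 V2])
  have C\<phi>: "integrable M (\<lambda>x. \<phi> x * C x)"
    unfolding C_def by (rule real_cond_exp_intg(1)[OF V\<phi> \<phi> V])
  have cross: "expectation (\<lambda>x. \<phi> x * C x) = expectation (\<lambda>x. \<phi> x * V x)"
    unfolding C_def by (rule real_cond_exp_intg(2)[OF V\<phi> \<phi> V])
  have "0 \<le> expectation (\<lambda>x. (C x - \<phi> x)\<^sup>2)" by simp
  also have "\<dots> = expectation (\<lambda>x. (C x)\<^sup>2 + (\<phi> x)\<^sup>2 - 2 * (\<phi> x * C x))"
    by (simp add: power2_diff algebra_simps)
  also have "\<dots> = expectation (\<lambda>x. (C x)\<^sup>2) + expectation (\<lambda>x. (\<phi> x)\<^sup>2)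
                    - 2 * expectation (\<lambda>x. \<phi> x * C x)"
    using C2 \<phi>2 C\<phi> by simp
  finally have "expectation (\<lambda>x. (V x)\<^sup>2) - expectation (\<lambda>x. (C x)\<^sup>2)
      \<le> expectation (\<lambda>x. (V x)\<^sup>2) + expectation (\<lambda>x. (\<phi> x)\<^sup>2) - 2 * expectation (\<lambda>x. \<phi> x * V x)"
    by (simp add: cross)
  also have "\<dots> = expectation (\<lambda>x. (V x)\<^sup>2 + (\<phi> x)\<^sup>2 - 2 * (\<phi> x * V x))"
    using V2 \<phi>2 V\<phi> by simp
  also have "\<dots> = expectation (\<lambda>x. (V x - \<phi> x)\<^sup>2)"
    by (simp add: power2_diff algebra_simps)
  finally show ?thesis
    using variance_eq[OF V1 V2] variance_eq[OF C1 C2] EC unfolding C_def by simp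
qed

section \<open>The variance bound\<close>

lemma integrable_square_lipschitz:
  fixes g :: "real \<Rightarrow> real"
  assumes M: "finite_measure M" and g: "L-lipschitz_on UNIV g"
    and [measurable]: "W \<in> borel_measurable M" and W: "integrable M (\<lambda>x. (W x)\<^sup>2)"
  shows "integrable M (\<lambda>x. (g (W x))\<^sup>2)"
proof (rule Bochner_Integration.integrable_bound)
  interpret finite_measure M by fact
  have [measurable]: "g \<in> borel_measurable borel"
    by (rule borel_measurable_continuous_onI lipschitz_on_continuous_on[OF g])+
  show "integrable M (\<lambda>x. 2 * (g 0)\<^sup>2 + 2 * L\<^sup>2 * (W x)\<^sup>2)" using W by simp
  show "(\<lambda>x. (g (W x))\<^sup>2) \<in> borel_measurable M" by measurable
  have "(g w)\<^sup>2 \<le> 2 * (g 0)\<^sup>2 + 2 * L\<^sup>2 * w\<^sup>2" for w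
  proof -
    have "(g w - g 0)\<^sup>2 \<le> (L * \<bar>w\<bar>)\<^sup>2"
      using lipschitz_onD[OF g, of w 0] by (intro power2_le_iff_abs_le[THEN iffD2])
        (auto simp: dist_real_def lipschitz_on_nonneg[OF g])
    moreover have "(g w)\<^sup>2 \<le> 2 * (g 0)\<^sup>2 + 2 * (g w - g 0)\<^sup>2"
      using zero_le_power2[of "g w - 2 * g 0"] by (simp add: power2_eq_square algebra_simps)
    ultimately show ?thesis by (simp add: power_mult_distrib)
  qed
  then show "AE x in M. norm ((g (W x))\<^sup>2) \<le> norm (2 * (g 0)\<^sup>2 + 2 * L\<^sup>2 * (W x)\<^sup>2)"
    by simp
qed

lemma (in prob_space) variance_add_indep_centered:
  fixes Y Z :: "'a \<Rightarrow> real"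
  assumes indep: "indep_var borel Y borel Z"
    and Y2: "integrable M (\<lambda>x. (Y x)\<^sup>2)" and Z2: "integrable M (\<lambda>x. (Z x)\<^sup>2)"
    and EY: "expectation Y = 0"
  shows "variance (\<lambda>x. Y x + Z x) = variance Y + variance Z"
proof -
  have [measurable]: "Y \<in> borel_measurable M" "Z \<in> borel_measurable M"
    using indep_var_rv1[OF indep] indep_var_rv2[OF indep] by auto
  have Y1: "integrable M Y" and Z1: "integrable M Z"
    using square_integrable_imp_integrable[OF _ Y2] square_integrable_imp_integrable[OF _ Z2] by auto
  have YZ: "integrable M (\<lambda>x. Y x * Z x)" "expectation (\<lambda>x. Y x * Z x) = 0"
    using indep_var_integrable[OF indep Y1 Z1] indep_var_lebesgue_integral[OF indep Y1 Z1] EY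
    by auto
  have "variance (\<lambda>x. Y x + Z x)
      = expectation (\<lambda>x. (Y x)\<^sup>2 + (Z x - expectation Z)\<^sup>2 + 2 * (Y x * Z x) - 2 * expectation Z * Y x)"
    using Y1 Z1 EY
    by (intro Bochner_Integration.integral_cong refl) (simp add: power2_eq_square algebra_simps)
  also have "\<dots> = variance Y + variance Z"
  proof -
    have "integrable M (\<lambda>x. (Z x - expectation Z)\<^sup>2)"
      using Z1 Z2 by (simp add: power2_diff)
    then show ?thesis using Y1 Y2 YZ EY by simp
  qed
  finally show ?thesis .
qed

theorem mainTheorem2:
  fixes M :: "'a measure"
    and X :: "'a \<Rightarrow> real ^ 'n"
    and i1 :: 'n
    and h f :: "real ^ 'n \<Rightarrow> real"
    and g :: "real \<Rightarrow> real"
    and L :: real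
    and a :: "real ^ 'n"
    and U :: "real ^ 'n ^ 'n"
    and Y Z :: "'a \<Rightarrow> real"
  assumes "prob_space M"
    and "prob_space.indep_vars M (\<lambda>_. borel) (\<lambda>j \<omega>. X \<omega> $ j) UNIV"
    and "\<And>j. distributed M lborel (\<lambda>\<omega>. X \<omega> $ j) std_normal_density"
    and "h \<in> borel_measurable borel"
    and "integrable M (\<lambda>\<omega>. (h (X \<omega>))\<^sup>2)"
    and "L-lipschitz_on UNIV g"
    and "f = g \<circ> h"
    and "a = (\<chi> j. prob_space.expectation M (\<lambda>\<omega>. X \<omega> $ j * h (X \<omega>)))"
    and "norm a = 0 \<Longrightarrow> U = mat 1"
    and "norm a \<noteq> 0 \<Longrightarrow> householder U \<and> U *v axis i1 1 = a /\<^sub>R norm a"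
    and "Y = (\<lambda>\<omega>. norm a * X \<omega> $ i1)"
    and "Z = (\<lambda>\<omega>. h (U *v X \<omega>) - norm a * X \<omega> $ i1)"
    and "prob_space.indep_var M borel Y borel Z"
  shows "prob_space.variance M (\<lambda>\<omega>. f (U *v X \<omega>))
           - prob_space.variance M
               (cond_exp_given M (\<lambda>\<omega>. X \<omega> $ i1) (\<lambda>\<omega>. f (U *v X \<omega>)))
         \<le> 2 * L\<^sup>2 * (prob_space.variance M (\<lambda>\<omega>. h (U *v X \<omega>)) - (norm a)\<^sup>2)"
proof -
  interpret prob_space M by (rule assms(1))
  note indep = assms(2) and dist = assms(3) and h[measurable] = assms(4) and h2 = assms(5)
    and g = assms(6) and f = assms(7) and Y = assms(11) and Z = assms(12) and YZ = assms(13)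
  have [measurable]: "(\<lambda>\<omega>. X \<omega> $ j) \<in> borel_measurable M" for j
    using distributed_measurable[OF dist[of j]] by simp
  have X[measurable]: "X \<in> borel_measurable M"
    by (rule borel_measurable_vec) simp
  have g_meas[measurable]: "g \<in> borel_measurable borel"
    by (rule borel_measurable_continuous_onI lipschitz_on_continuous_on[OF g])+
  have orth: "orthogonal_transformation ((*v) U)"
  proof (cases "norm a = 0")
    case True
    have "(*v) (mat 1 :: real ^ 'n ^ 'n) = (\<lambda>x. x)" by (simp add: fun_eq_iff)
    then show ?thesis using assms(9)[OF True] by (metis orthogonal_transformation_id)
  next
    case False
    then show ?thesis using assms(10) householder_orthogonal by blast
  qed
  note [measurable] = orthogonal_transformation_borel_measurable[OF orth]
  have UX[measurable]: "(\<lambda>\<omega>. U *v X \<omega>) \<in> borel_measurable M" by simp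
  define S where "S \<omega> = h (U *v X \<omega>)" for \<omega>
  have S[measurable]: "S \<in> borel_measurable M" unfolding S_def by measurable
  have S2: "integrable M (\<lambda>\<omega>. (S \<omega>)\<^sup>2)"
  proof -
    have "integrable (distr M borel X) (\<lambda>x. (h x)\<^sup>2)"
      using h2 by (simp add: integrable_distr_eq)
    then have "integrable (distr M borel (\<lambda>\<omega>. U *v X \<omega>)) (\<lambda>x. (h x)\<^sup>2)"
      by (simp add: std_normal_vector_orthogonal_distr[OF indep dist orth])
    then show ?thesis by (simp add: integrable_distr_eq S_def)
  qed
  let ?W = "\<lambda>\<omega>. X \<omega> $ i1"
  have EW: "expectation ?W = 0"
    by (rule standard_normal_distributed_expectation[OF dist])
  have EW2: "expectation (\<lambda>\<omega>. (?W \<omega>)\<^sup>2) = 1"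
    using standard_normal_distributed_variance[OF dist[of i1]] EW by simp
  have W2: "integrable M (\<lambda>\<omega>. (?W \<omega>)\<^sup>2)"
    \<comment> \<open>A non-integrable function has integral 0 by convention, so the value 1 settles it.\<close>
    using EW2 not_integrable_integral_eq by force
  have Y2: "integrable M (\<lambda>\<omega>. (Y \<omega>)\<^sup>2)" and EY: "expectation Y = 0"
    and VY: "variance Y = (norm a)\<^sup>2"
    using W2 EW EW2 by (simp_all add: Y power_mult_distrib)
  have [measurable]: "Y \<in> borel_measurable M" "Z \<in> borel_measurable M"
    using indep_var_rv1[OF YZ] indep_var_rv2[OF YZ] by auto
  have ZS: "Z \<omega> = S \<omega> - Y \<omega>" for \<omega> by (simp add: Z Y S_def)
  have Z2: "integrable M (\<lambda>\<omega>. (Z \<omega>)\<^sup>2)"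
    using S2 Y2 integrable_mult_of_square[OF S _ S2 Y2] by (simp add: ZS power2_diff mult.assoc)
  have Z1: "integrable M Z" using square_integrable_imp_integrable[OF _ Z2] by simp
  have VS: "variance S - (norm a)\<^sup>2 = variance Z"
  proof -
    have S_eq: "S = (\<lambda>\<omega>. Y \<omega> + Z \<omega>)" by (simp add: ZS fun_eq_iff)
    show ?thesis
      unfolding S_eq using variance_add_indep_centered[OF YZ Y2 Z2 EY] VY by simp
  qed

  define F where "F = vimage_algebra (space M) ?W borel"
  have W_F[measurable]: "?W \<in> borel_measurable F"
    unfolding F_def by (rule measurable_vimage_algebra1) simp
  have sub: "subalgebra M F"
    unfolding subalgebra_def F_def by (auto simp: sets_vimage_algebra2)
  \<comment> \<open>The competitor for the conditional expectation: \<open>Z\<close> is replaced by its mean.\<close>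
  define \<phi> where "\<phi> \<omega> = g (Y \<omega> + expectation Z)" for \<omega>
  have \<phi>_F: "\<phi> \<in> borel_measurable F"
    unfolding \<phi>_def Y by measurable
  have "integrable M Y" using square_integrable_imp_integrable[OF _ Y2] by simp
  then have \<phi>2: "integrable M (\<lambda>\<omega>. (\<phi> \<omega>)\<^sup>2)"
    unfolding \<phi>_def using Y2
    by (intro integrable_square_lipschitz[OF finite_measure g]) (auto simp: power2_sum)
  have gS2: "integrable M (\<lambda>\<omega>. (g (S \<omega>))\<^sup>2)"
    by (rule integrable_square_lipschitz[OF finite_measure g S S2])
  have lip: "(g (S \<omega>) - \<phi> \<omega>)\<^sup>2 \<le> L\<^sup>2 * (Z \<omega> - expectation Z)\<^sup>2" for \<omega>
  proof -
    have "\<bar>g (S \<omega>) - \<phi> \<omega>\<bar> \<le> L * \<bar>Z \<omega> - expectation Z\<bar>"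
      using lipschitz_onD[OF g, of "S \<omega>" "Y \<omega> + expectation Z"]
      by (simp add: \<phi>_def dist_real_def ZS algebra_simps)
    then have "\<bar>g (S \<omega>) - \<phi> \<omega>\<bar>\<^sup>2 \<le> (L * \<bar>Z \<omega> - expectation Z\<bar>)\<^sup>2"
      by (rule power_mono) simp
    then show ?thesis by (simp add: power_mult_distrib)
  qed
  have "variance (\<lambda>\<omega>. g (S \<omega>)) - variance (real_cond_exp M F (\<lambda>\<omega>. g (S \<omega>)))
      \<le> expectation (\<lambda>\<omega>. (g (S \<omega>) - \<phi> \<omega>)\<^sup>2)"
    by (rule variance_cond_exp_gap_le[OF sub _ gS2 \<phi>_F \<phi>2]) measurable
  also have "\<dots> \<le> expectation (\<lambda>\<omega>. L\<^sup>2 * (Z \<omega> - expectation Z)\<^sup>2)"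
  proof (rule integral_mono')
    show "integrable M (\<lambda>\<omega>. L\<^sup>2 * (Z \<omega> - expectation Z)\<^sup>2)"
      using Z1 Z2 by (simp add: power2_diff)
  qed (use lip in auto)
  also have "\<dots> = L\<^sup>2 * variance Z" by simp
  also have "\<dots> \<le> 2 * L\<^sup>2 * variance Z"
    using variance_positive[of Z] by (simp add: mult_right_mono)
  also have "\<dots> = 2 * L\<^sup>2 * (variance S - (norm a)\<^sup>2)" by (simp add: VS)
  finally show ?thesis
    by (simp add: cond_exp_given_def F_def f S_def[abs_def] comp_def)
qed

end
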